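(* Let $n\ge m\ge 1$. Then $\lambda_3(m,n)\le mn/4$, and $\lambda_4(m,n)\le (1+o(1))\, m^2 n/8$ (as $n\to\infty$).
   Context: $K_{m,n}$ denotes the complete bipartite graph with vertex classes $M$, $|M|=m$, and $N$, $|N|=n$. A path is alternating if any two adjacent edges of it have different colors; the length of a path is its number of edges. $\lambda_{\ell}(m,n)$ is the maximum $t$ such that there is a $2$-edge-coloring of $K_{m,n}$ in which every pair of vertices is connected by $t$ (not necessarily internally disjoint) alternating paths of length $\ell$; for even $\ell$ only pairs of distinct vertices in the class $N$ of size $n$ are considered, and for odd $\ell$ the pairs consist of one vertex from each class. *)

theory Defs
  imports Complex_Main
begin

text \<open>The graph \<open>K_{m,n}\<close>: the class \<open>M\<close> consists of the \<open>Inl i\<close> with \<open>i < m\<close>,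
  the class \<open>N\<close> of the \<open>Inr j\<close> with \<open>j < n\<close>; edges are two-element vertex sets.\<close>

type_synonym vertex = "nat + nat"

definition class_M :: "nat \<Rightarrow> vertex set" where
  "class_M m = Inl ` {..<m}"

definition class_N :: "nat \<Rightarrow> vertex set" where
  "class_N n = Inr ` {..<n}"

definition edges_K :: "nat \<Rightarrow> nat \<Rightarrow> vertex set set" where
  "edges_K m n = {{u, v} | u v. u \<in> class_M m \<and> v \<in> class_N n}"

fun path_edges :: "vertex list \<Rightarrow> vertex set list" where
  "path_edges (u # v # p) = {u, v} # path_edges (v # p)"
| "path_edges _ = []"

definition is_path :: "nat \<Rightarrow> nat \<Rightarrow> vertex list \<Rightarrow> bool" where
  "is_path m n p \<longleftrightarrow> p \<noteq> [] \<and> distinct p \<and> set p \<subseteq> class_M m \<union> class_N n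
     \<and> set (path_edges p) \<subseteq> edges_K m n"

text \<open>A 2-edge-coloring is a function \<open>c :: vertex set \<Rightarrow> bool\<close>; only its values on edges matter.\<close>

definition alternating :: "(vertex set \<Rightarrow> bool) \<Rightarrow> vertex list \<Rightarrow> bool" where
  "alternating c p \<longleftrightarrow> successively (\<lambda>e f. c e \<noteq> c f) (path_edges p)"

text \<open>For \<open>u \<noteq> v\<close>, listing the vertices from \<open>u\<close> to \<open>v\<close> represents each undirected
  path between \<open>u\<close> and \<open>v\<close> exactly once.\<close>

definition alt_paths ::
  "nat \<Rightarrow> nat \<Rightarrow> (vertex set \<Rightarrow> bool) \<Rightarrow> nat \<Rightarrow> vertex \<Rightarrow> vertex \<Rightarrow> vertex list set" where
  "alt_paths m n c l u v =
     {p. is_path m n p \<and> alternating c p \<and> length (path_edges p) = l \<and> hd p = u \<and> last p = v}"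

definition vertex_pairs :: "nat \<Rightarrow> nat \<Rightarrow> nat \<Rightarrow> (vertex \<times> vertex) set" where
  "vertex_pairs l m n =
     (if even l then {(u, v). u \<in> class_N n \<and> v \<in> class_N n \<and> u \<noteq> v}
      else class_M m \<times> class_N n)"

text \<open>The set below contains \<open>0\<close> and is finite whenever there is a pair to consider. The only
  degenerate case with \<open>n \<ge> m \<ge> 1\<close> is \<open>n = 1\<close> with even \<open>l\<close>, where the maximum does not
  exist and the value is unspecified.\<close>

definition alt_lambda :: "nat \<Rightarrow> nat \<Rightarrow> nat \<Rightarrow> nat" where
  "alt_lambda l m n =
     Max {t. \<exists>c. \<forall>(u, v) \<in> vertex_pairs l m n. t \<le> card (alt_paths m n c l u v)}"

end

theory Submission
  imports Defs "HOL-Analysis.Convex"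
begin

text \<open>Encode the coloring by signs \<open>f x y = \<plusminus>1\<close>. A walk of length 3 or 4 is alternating iff
  the product of the factors \<open>(1 - f e * f e') / 2\<close> over consecutive edges \<open>e, e'\<close> is 1 and not 0.
  Expanding the product and summing over all walks, the main term is the number of all walks divided
  by 4 resp. 8, and the remaining terms, expressed through the signed degrees of the vertices, are
  together nonpositive by Cauchy--Schwarz. Averaging over the pairs of endpoints gives the bounds;
  for length 4 the factor \<open>n / (n - 1)\<close> appears because only distinct endpoints are allowed.\<close>

section \<open>Sums of sign products over walks\<close>

lemma sum_squared_le_card:
  fixes g :: "'a \<Rightarrow> real"
  shows "(\<Sum>i\<in>A. g i)\<^sup>2 \<le> real (card A) * (\<Sum>i\<in>A. (g i)\<^sup>2)"
  using Cauchy_Schwarz_ineq_sum[of "\<lambda>_. 1" g A] by simp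

lemma sum_rotate:
  "(\<Sum>u\<in>A. \<Sum>v\<in>B. \<Sum>w\<in>C. g u v w) = (\<Sum>w\<in>C. \<Sum>u\<in>A. \<Sum>v\<in>B. g u v w)"
  by (subst sum.swap[of _ C B]) (rule sum.swap)

text \<open>The walks run \<open>u, y, x, v\<close>. As \<open>f x y\<close> squares to 1, the
  product expands into four terms: a constant, one giving the squared signed degrees
  \<open>G\<close> of the class \<open>N\<close>, one giving those \<open>H\<close> of the class
  \<open>M\<close>, and one giving the square of the total \<open>F\<close>. By Cauchy-Schwarz over
  the \<open>n\<close> values of \<open>G\<close>, the negative \<open>G\<close> term absorbs
  \<open>F\<^sup>2\<close>; the \<open>H\<close> term is nonpositive.\<close>

lemma sum_alternating_3walks_le:
  fixes f :: "nat \<Rightarrow> nat \<Rightarrow> real"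
  assumes f: "\<And>x y. (f x y)\<^sup>2 = 1"
  shows "(\<Sum>u<m. \<Sum>v<n. \<Sum>y<n. \<Sum>x<m.
            (1 - f u y * f x y) / 2 * ((1 - f x y * f x v) / 2))
         \<le> (real m * real n) * (real m * real n / 4)"
proof -
  define G where "G y = (\<Sum>x<m. f x y)" for y
  define H where "H x = (\<Sum>y<n. f x y)" for x
  define F where "F = (\<Sum>y<n. G y)"
  have F': "F = (\<Sum>x<m. H x)"
    unfolding F_def G_def H_def by (rule sum.swap)
  have expand: "(1 - f u y * f x y) / 2 * ((1 - f x y * f x v) / 2)
      = (1 - f u y * f x y - f x y * f x v + f u y * f x v) / 4" for u v x y
    using f[of x y] by (simp add: field_simps power2_eq_square)
  have S1: "(\<Sum>u<m. \<Sum>v<n. \<Sum>y<n. \<Sum>x<m. f u y * f x y) = real n * (\<Sum>y<n. (G y)\<^sup>2)"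
  proof -
    have "(\<Sum>u<m. \<Sum>v<n. \<Sum>y<n. \<Sum>x<m. f u y * f x y)
        = real n * (\<Sum>u<m. \<Sum>y<n. \<Sum>x<m. f u y * f x y)"
      by (simp add: sum_distrib_left)
    also have "(\<Sum>u<m. \<Sum>y<n. \<Sum>x<m. f u y * f x y) = (\<Sum>y<n. \<Sum>u<m. \<Sum>x<m. f u y * f x y)"
      by (rule sum.swap)
    finally show ?thesis by (simp add: G_def power2_eq_square sum_product)
  qed
  have S2: "(\<Sum>u<m. \<Sum>v<n. \<Sum>y<n. \<Sum>x<m. f x y * f x v) = real m * (\<Sum>x<m. (H x)\<^sup>2)"
  proof -
    have "(\<Sum>v<n. \<Sum>y<n. \<Sum>x<m. f x y * f x v) = (\<Sum>v<n. \<Sum>x<m. \<Sum>y<n. f x y * f x v)"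
      by (rule sum.cong[OF refl sum.swap])
    also have "\<dots> = (\<Sum>x<m. \<Sum>v<n. \<Sum>y<n. f x y * f x v)"
      by (rule sum.swap)
    also have "\<dots> = (\<Sum>x<m. (H x)\<^sup>2)"
      by (simp add: H_def power2_eq_square sum_product mult.commute)
    finally show ?thesis by simp
  qed
  have S3: "(\<Sum>u<m. \<Sum>v<n. \<Sum>y<n. \<Sum>x<m. f u y * f x v) = F\<^sup>2"
  proof -
    have "(\<Sum>v<n. \<Sum>y<n. \<Sum>x<m. f u y * f x v) = H u * F" for u
    proof -
      have "(\<Sum>y<n. \<Sum>x<m. f u y * f x v) = H u * G v" for v
        by (simp add: H_def G_def sum_product)
      then show ?thesis by (simp add: F_def sum_distrib_left)
    qed
    then show ?thesis by (simp add: power2_eq_square F' sum_distrib_right)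
  qed
  have "F\<^sup>2 \<le> real n * (\<Sum>y<n. (G y)\<^sup>2)"
    unfolding F_def using sum_squared_le_card[of G "{..<n}"] by simp
  moreover have "0 \<le> real m * (\<Sum>x<m. (H x)\<^sup>2)"
    by (simp add: sum_nonneg)
  moreover have "(\<Sum>u<m. \<Sum>v<n. \<Sum>y<n. \<Sum>x<m.
            (1 - f u y * f x y) / 2 * ((1 - f x y * f x v) / 2))
     = ((real m * real n) * (real m * real n) - real n * (\<Sum>y<n. (G y)\<^sup>2)
         - real m * (\<Sum>x<m. (H x)\<^sup>2) + F\<^sup>2) / 4"
    unfolding expand sum_divide_distrib[symmetric] sum.distrib sum_subtractf S1 S2 S3
    by (simp add: algebra_simps)
  ultimately show ?thesis by simp
qed

text \<open>For a fixed middle part \<open>x, w, z\<close> of the walk \<open>u, x, w, z, v\<close>,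
  the sums over \<open>u\<close> and \<open>v\<close> are independent. Two positive corrections
  remain, the sum of the \<open>(P w)\<^sup>2\<close> and \<open>n * S\<^sup>2\<close>. Each is at
  most \<open>n * m * Q\<close>, so \<open>- 2 * n * m * Q\<close> pays for both, and the
  \<open>G\<close> term is nonpositive.\<close>

lemma sum_alternating_4walks_le:
  fixes f :: "nat \<Rightarrow> nat \<Rightarrow> real"
  assumes f: "\<And>x y. (f x y)\<^sup>2 = 1"
  shows "(\<Sum>u<n. \<Sum>v<n. \<Sum>w<n. \<Sum>x<m. \<Sum>z<m.
            (1 - f x u * f x w) / 2 * ((1 - f x w * f z w) / 2) * ((1 - f z w * f z v) / 2))
         \<le> (real m)\<^sup>2 * real n ^ 3 / 8" (is "?T \<le> _")
proof -
  define G where "G y = (\<Sum>x<m. f x y)" for y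
  define H where "H x = (\<Sum>y<n. f x y)" for x
  \<comment> \<open>\<open>P w\<close> is the signed degree of \<open>w\<close> with every neighbour
    weighted by its own signed degree. Its sum over \<open>w\<close> is \<open>Q\<close>, so the
    linear term in \<open>P\<close> becomes the negative multiple of \<open>Q\<close> that controls
    the rest.\<close>
  define P where "P w = (\<Sum>x<m. H x * f x w)" for w
  define S where "S = (\<Sum>x<m. H x)"
  define Q where "Q = (\<Sum>x<m. (H x)\<^sup>2)"
  have S': "S = (\<Sum>y<n. G y)"
    unfolding S_def G_def H_def by (rule sum.swap)
  have Q': "Q = (\<Sum>w<n. P w)"
    unfolding Q_def P_def H_def power2_eq_square sum_distrib_left by (rule sum.swap)
  have ends: "(\<Sum>u<n. \<Sum>v<n. (1 - f x u * f x w) / 2 * ((1 - f x w * f z w) / 2) * ((1 - f z w * f z v) / 2))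
      = (real n - H x * f x w) * (1 - f x w * f z w) * (real n - H z * f z w) / 8" for x z w
  proof -
    have "(\<Sum>v<n. (1 - f z w * f z v) / 2) = (real n - H z * f z w) / 2"
      "(\<Sum>v<n. (1 - f x v * f x w) / 2) = (real n - H x * f x w) / 2"
      by (simp_all add: H_def sum_subtractf sum_divide_distrib[symmetric] sum_distrib_left mult.commute)
    then show ?thesis
      by (simp only: sum_distrib_left[symmetric] sum_distrib_right[symmetric])
  qed
  have inner: "(\<Sum>x<m. \<Sum>z<m. (real n - H x * f x w) * (1 - f x w * f z w) * (real n - H z * f z w))
      = (real n)\<^sup>2 * (real m)\<^sup>2 - 2 * real n * real m * P w + (P w)\<^sup>2 - (real n)\<^sup>2 * (G w)\<^sup>2
        + 2 * real n * S * G w - S\<^sup>2" for w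
  proof -
    \<comment> \<open>Since signs square to 1, \<open>H x * f x w\<close> times
      \<open>f x w * f z w\<close> is \<open>H x * f z w\<close>, and likewise for \<open>z\<close>.
      Each term is then a function of \<open>x\<close> times a function of \<open>z\<close>, so the
      double sum factors.\<close>
    have expand: "(real n - H x * f x w) * (1 - f x w * f z w) * (real n - H z * f z w)
       = (real n)\<^sup>2 - real n * (H x * f x w) - real n * (H z * f z w)
         + (H x * f x w) * (H z * f z w) - (real n)\<^sup>2 * (f x w * f z w)
         + real n * (H x * f z w) + real n * (f x w * H z) - H x * H z" for x z
      using f[of x w] f[of z w] by algebra
    show ?thesis
      unfolding expand sum.distrib sum_subtractf sum_constant card_lessThan
        sum_distrib_left[symmetric] sum_distrib_right[symmetric] P_def[symmetric] G_def[symmetric] S_def[symmetric]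
      by (simp add: power2_eq_square algebra_simps)
  qed
  \<comment> \<open>The signs disappear on squaring, which makes the bound uniform in
    \<open>w\<close>.\<close>
  have PQ: "(P w)\<^sup>2 \<le> real m * Q" for w
    using sum_squared_le_card[of "\<lambda>x. H x * f x w" "{..<m}"]
    by (simp add: P_def Q_def power_mult_distrib f)
  have "?T = (\<Sum>w<n. \<Sum>x<m. \<Sum>z<m. \<Sum>u<n. \<Sum>v<n.
            (1 - f x u * f x w) / 2 * ((1 - f x w * f z w) / 2) * ((1 - f z w * f z v) / 2))"
    by (subst sum_rotate, rule sum.cong[OF refl], subst sum_rotate, rule sum.cong[OF refl], rule sum_rotate)
  also have "\<dots> = (\<Sum>w<n. \<Sum>x<m. \<Sum>z<m. (real n - H x * f x w) * (1 - f x w * f z w) * (real n - H z * f z w)) / 8"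
    unfolding ends sum_divide_distrib[symmetric] ..
  \<comment> \<open>The value of \<open>?T\<close> is substituted inside \<open>8 * \<dots>\<close>,
    so the chain ends in an equation for \<open>8 * ?T\<close>.\<close>
  also have "8 * \<dots> = real n * ((real n)\<^sup>2 * (real m)\<^sup>2) - 2 * real n * real m * Q + (\<Sum>w<n. (P w)\<^sup>2)
      - (real n)\<^sup>2 * (\<Sum>w<n. (G w)\<^sup>2) + 2 * real n * S * S - real n * S\<^sup>2"
    unfolding inner by (simp add: sum.distrib sum_subtractf Q' S' flip: sum_distrib_left)
  finally have T: "8 * ?T = real n * ((real n)\<^sup>2 * (real m)\<^sup>2) - 2 * real n * real m * Q
      + (\<Sum>w<n. (P w)\<^sup>2) - (real n)\<^sup>2 * (\<Sum>w<n. (G w)\<^sup>2) + 2 * real n * S * S - real n * S\<^sup>2" .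
  have "(\<Sum>w<n. (P w)\<^sup>2) \<le> real n * (real m * Q)"
    using sum_bounded_above[of "{..<n}" "\<lambda>w. (P w)\<^sup>2", OF PQ] by simp
  moreover have "real n * S\<^sup>2 \<le> real n * (real m * Q)"
    unfolding S_def Q_def using sum_squared_le_card[of H "{..<m}"] by (simp add: mult_left_mono)
  moreover have "0 \<le> (real n)\<^sup>2 * (\<Sum>w<n. (G w)\<^sup>2)"
    by (simp add: sum_nonneg)
  ultimately have "8 * ?T \<le> real n * ((real n)\<^sup>2 * (real m)\<^sup>2)"
    unfolding T by (simp add: power2_eq_square algebra_simps)
  then show ?thesis by (simp add: power2_eq_square power3_eq_cube mult_ac)
qed

section \<open>From alternating paths to edge signs\<close>

lemma length_path_edges: "length (path_edges p) = length p - 1"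
  by (induction p rule: path_edges.induct) auto

lemma edge_from_M: "{Inl u, b} \<in> edges_K m n \<longleftrightarrow> u < m \<and> (\<exists>y<n. b = Inr y)"
  by (auto simp: edges_K_def class_M_def class_N_def doubleton_eq_iff)

lemma edge_from_N: "{Inr v, b} \<in> edges_K m n \<longleftrightarrow> v < n \<and> (\<exists>x<m. b = Inl x)"
  by (auto simp: edges_K_def class_M_def class_N_def doubleton_eq_iff)

text \<open>Brings edges traversed from \<open>N\<close> to \<open>M\<close> into the orientation
  used by \<open>edge_sign\<close>.\<close>

lemma Inr_Inl_doubleton: "{Inr y, Inl x} = {Inl x, Inr y}"
  by (rule insert_commute)

definition edge_sign :: "(vertex set \<Rightarrow> bool) \<Rightarrow> nat \<Rightarrow> nat \<Rightarrow> real" where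
  "edge_sign c x y = (if c {Inl x, Inr y} then 1 else -1)"

lemma edge_sign_squared: "(edge_sign c x y)\<^sup>2 = 1"
  by (simp add: edge_sign_def)

lemma of_bool_edges_differ:
  "of_bool (c {Inl x, Inr y} \<noteq> c {Inl x', Inr y'}) = (1 - edge_sign c x y * edge_sign c x' y') / 2"
  by (simp add: edge_sign_def)

text \<open>A path with given ends is determined by its inner vertices \<open>y, x\<close>, and the
  product of the factors is the indicator of the two color changes. For an upper bound it suffices
  that the paths lie in the image of \<open>W\<close>.\<close>

lemma card_alt_paths_3_le:
  "real (card (alt_paths m n c 3 (Inl u) (Inr v)))
    \<le> (\<Sum>y<n. \<Sum>x<m. (1 - edge_sign c u y * edge_sign c x y) / 2
          * ((1 - edge_sign c x y * edge_sign c x v) / 2))"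
proof -
  define W where "W = {(y, x) \<in> {..<n} \<times> {..<m}. c {Inl u, Inr y} \<noteq> c {Inl x, Inr y}
                        \<and> c {Inl x, Inr y} \<noteq> c {Inl x, Inr v}}"
  have fin: "finite W" unfolding W_def by (rule finite_subset[of _ "{..<n} \<times> {..<m}"]) auto
  have "alt_paths m n c 3 (Inl u) (Inr v) \<subseteq> (\<lambda>(y, x). [Inl u, Inr y, Inl x, Inr v]) ` W"
  proof
    fix p assume p: "p \<in> alt_paths m n c 3 (Inl u) (Inr v)"
    then have "length p = Suc (Suc (Suc (Suc 0)))"
      by (auto simp: alt_paths_def length_path_edges)
    then obtain a b d e where "p = [a, b, d, e]"
      by (auto simp: length_Suc_conv)
    with p obtain y x where "p = [Inl u, Inr y, Inl x, Inr v]" "y < n" "x < m"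
      by (auto simp: alt_paths_def is_path_def edge_from_M edge_from_N)
    with p show "p \<in> (\<lambda>(y, x). [Inl u, Inr y, Inl x, Inr v]) ` W"
      by (auto simp: alt_paths_def alternating_def W_def Inr_Inl_doubleton
          intro!: image_eqI[of _ _ "(y, x)"])
  qed
  then have "card (alt_paths m n c 3 (Inl u) (Inr v)) \<le> card W"
    using fin surj_card_le by blast
  also have "real (card W) = (\<Sum>(y, x)\<in>{..<n} \<times> {..<m}. of_bool (c {Inl u, Inr y} \<noteq> c {Inl x, Inr y}
                        \<and> c {Inl x, Inr y} \<noteq> c {Inl x, Inr v}))"
    by (simp add: W_def of_bool_def sum.If_cases case_prod_unfold Int_def mem_Times_iff)
  finally show ?thesis
    by (simp only: of_bool_conj of_bool_edges_differ sum.cartesian_product)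
qed

lemma card_alt_paths_4_le:
  "real (card (alt_paths m n c 4 (Inr u) (Inr v)))
    \<le> (\<Sum>w<n. \<Sum>x<m. \<Sum>z<m. (1 - edge_sign c x u * edge_sign c x w) / 2
          * ((1 - edge_sign c x w * edge_sign c z w) / 2)
          * ((1 - edge_sign c z w * edge_sign c z v) / 2))"
proof -
  \<comment> \<open>The conjunction is bracketed to the left so that \<open>of_bool_conj\<close>
    yields the product exactly as it is associated in the claim.\<close>
  define W where "W = {(w, x, z) \<in> {..<n} \<times> {..<m} \<times> {..<m}.
      (c {Inl x, Inr u} \<noteq> c {Inl x, Inr w} \<and> c {Inl x, Inr w} \<noteq> c {Inl z, Inr w})
      \<and> c {Inl z, Inr w} \<noteq> c {Inl z, Inr v}}"
  have fin: "finite W"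
    unfolding W_def by (rule finite_subset[of _ "{..<n} \<times> {..<m} \<times> {..<m}"]) auto
  have "alt_paths m n c 4 (Inr u) (Inr v)
      \<subseteq> (\<lambda>(w, x, z). [Inr u, Inl x, Inr w, Inl z, Inr v]) ` W"
  proof
    fix p assume p: "p \<in> alt_paths m n c 4 (Inr u) (Inr v)"
    then have "length p = Suc (Suc (Suc (Suc (Suc 0))))"
      by (auto simp: alt_paths_def length_path_edges)
    then obtain a b d e g where "p = [a, b, d, e, g]"
      by (auto simp: length_Suc_conv)
    with p obtain x w z
      where "p = [Inr u, Inl x, Inr w, Inl z, Inr v]" "w < n" "x < m" "z < m"
      by (auto simp: alt_paths_def is_path_def edge_from_M edge_from_N)
    with p show "p \<in> (\<lambda>(w, x, z). [Inr u, Inl x, Inr w, Inl z, Inr v]) ` W"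
      by (auto simp: alt_paths_def alternating_def W_def Inr_Inl_doubleton
          intro!: image_eqI[of _ _ "(w, x, z)"])
  qed
  then have "card (alt_paths m n c 4 (Inr u) (Inr v)) \<le> card W"
    using fin surj_card_le by blast
  also have "real (card W) = (\<Sum>(w, x, z)\<in>{..<n} \<times> {..<m} \<times> {..<m}.
      of_bool ((c {Inl x, Inr u} \<noteq> c {Inl x, Inr w} \<and> c {Inl x, Inr w} \<noteq> c {Inl z, Inr w})
      \<and> c {Inl z, Inr w} \<noteq> c {Inl z, Inr v}))"
    by (simp add: W_def of_bool_def sum.If_cases case_prod_unfold Int_def mem_Times_iff)
  finally show ?thesis
    by (simp only: of_bool_conj of_bool_edges_differ sum.cartesian_product)
qed

section \<open>Averaging over pairs of endpoints\<close>

text \<open>The bound \<open>B\<close> on every admissible \<open>t\<close> makes the set of these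
  \<open>t\<close> finite, and it contains 0, so \<open>Max\<close> is attained and is itself
  admissible.\<close>

lemma alt_lambda_le:
  fixes B :: real
  assumes "\<And>t c. (\<And>u v. (u, v) \<in> vertex_pairs l m n \<Longrightarrow> t \<le> card (alt_paths m n c l u v))
             \<Longrightarrow> real t \<le> B"
  shows "real (alt_lambda l m n) \<le> B"
proof -
  define T where "T = {t. \<exists>c. \<forall>(u, v) \<in> vertex_pairs l m n. t \<le> card (alt_paths m n c l u v)}"
  have le: "real t \<le> B" if "t \<in> T" for t
    using that assms unfolding T_def by blast
  have "T \<subseteq> {..nat \<lfloor>B\<rfloor>}"
    using le by (auto simp: le_nat_floor)
  then have "finite T" by (rule finite_subset) simp
  moreover have "0 \<in> T" by (auto simp: T_def)
  ultimately have "Max T \<in> T" by (intro Max_in) auto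
  then show ?thesis using le by (simp add: alt_lambda_def T_def)
qed

lemma alt_lambda_3_le:
  assumes "0 < m" "0 < n"
  shows "real (alt_lambda 3 m n) \<le> real m * real n / 4"
proof (rule alt_lambda_le)
  fix t c
  assume t: "\<And>u v. (u, v) \<in> vertex_pairs 3 m n \<Longrightarrow> t \<le> card (alt_paths m n c 3 u v)"
  let ?f = "edge_sign c"
  have "(real m * real n) * real t = (\<Sum>u<m. \<Sum>v<n. real t)" by simp
  also have "\<dots> \<le> (\<Sum>u<m. \<Sum>v<n. \<Sum>y<n. \<Sum>x<m.
            (1 - ?f u y * ?f x y) / 2 * ((1 - ?f x y * ?f x v) / 2))"
  proof (intro sum_mono)
    fix u v assume "u \<in> {..<m}" "v \<in> {..<n}"
    then have "t \<le> card (alt_paths m n c 3 (Inl u) (Inr v))"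
      by (intro t) (auto simp: vertex_pairs_def class_M_def class_N_def)
    then show "real t \<le> (\<Sum>y<n. \<Sum>x<m. (1 - ?f u y * ?f x y) / 2 * ((1 - ?f x y * ?f x v) / 2))"
      using card_alt_paths_3_le[of m n c u v] by linarith
  qed
  also have "\<dots> \<le> (real m * real n) * (real m * real n / 4)"
    by (rule sum_alternating_3walks_le) (rule edge_sign_squared)
  \<comment> \<open>The common factor \<open>m * n\<close>, the number of endpoint pairs, cancels;
    the deleted simp rule would destroy the product form.\<close>
  finally show "real t \<le> real m * real n / 4"
    using assms by (simp del: times_divide_eq_right)
qed

text \<open>Only the \<open>n * (n - 1)\<close> ordered pairs of distinct endpoints contribute
  \<open>t\<close>, while the walk sum runs over all \<open>n\<^sup>2\<close> pairs. This gives the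
  factor \<open>n / (n - 1) = 1 + 1 / (n - 1)\<close>.\<close>

lemma alt_lambda_4_le:
  assumes "2 \<le> n"
  shows "real (alt_lambda 4 m n) \<le> (1 + 1 / (real n - 1)) * ((real m)\<^sup>2 * real n / 8)"
proof (rule alt_lambda_le)
  fix t c
  assume t: "\<And>u v. (u, v) \<in> vertex_pairs 4 m n \<Longrightarrow> t \<le> card (alt_paths m n c 4 u v)"
  let ?f = "edge_sign c"
  let ?s = "\<lambda>u v. \<Sum>w<n. \<Sum>x<m. \<Sum>z<m. (1 - ?f x u * ?f x w) / 2
          * ((1 - ?f x w * ?f z w) / 2) * ((1 - ?f z w * ?f z v) / 2)"
  have "(\<Sum>v<n. if u = v then 0 else real t) = (real n - 1) * real t" if "u < n" for u
  proof -
    have "(\<Sum>v<n. if u = v then 0 else real t) = (\<Sum>v\<in>{..<n} - {u}. real t)"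
      using that by (intro sum.mono_neutral_cong_right) auto
    then show ?thesis using that by (simp add: of_nat_diff)
  qed
  then have "real n * ((real n - 1) * real t) = (\<Sum>u<n. \<Sum>v<n. if u = v then 0 else real t)"
    by simp
  also have "\<dots> \<le> (\<Sum>u<n. \<Sum>v<n. ?s u v)"
  proof (intro sum_mono)
    fix u v assume uv: "u \<in> {..<n}" "v \<in> {..<n}"
    have "t \<le> card (alt_paths m n c 4 (Inr u) (Inr v))" if "u \<noteq> v"
      using that uv by (intro t) (auto simp: vertex_pairs_def class_N_def)
    \<comment> \<open>On the diagonal, \<open>?s u u\<close> is nonnegative because it bounds a
      cardinality.\<close>
    then show "(if u = v then 0 else real t) \<le> ?s u v"
      using card_alt_paths_4_le[of m n c u v] by (cases "u = v"; simp; linarith)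
  qed
  also have "\<dots> \<le> (real m)\<^sup>2 * real n ^ 3 / 8"
    by (rule sum_alternating_4walks_le) (rule edge_sign_squared)
  also have "\<dots> = real n * ((real m)\<^sup>2 * (real n)\<^sup>2 / 8)"
    by (simp add: power2_eq_square power3_eq_cube)
  finally have "(real n - 1) * real t \<le> (real m)\<^sup>2 * (real n)\<^sup>2 / 8"
    using assms by (simp del: times_divide_eq_right)
  then show "real t \<le> (1 + 1 / (real n - 1)) * ((real m)\<^sup>2 * real n / 8)"
    using assms by (simp add: field_simps power2_eq_square)
qed

theorem theorem4p2:
  shows "(\<forall>m n :: nat. 1 \<le> m \<and> m \<le> n \<longrightarrow>
            real (alt_lambda 3 m n) \<le> real m * real n / 4) \<and>
         (\<exists>\<epsilon> :: nat \<Rightarrow> real. \<epsilon> \<longlonglongrightarrow> 0 \<and>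
            (\<forall>m n :: nat. 1 \<le> m \<and> m \<le> n \<longrightarrow>
               real (alt_lambda 4 m n) \<le> (1 + \<epsilon> n) * ((real m)\<^sup>2 * real n / 8)))"
proof (intro conjI exI allI impI)
  fix m n :: nat assume "1 \<le> m \<and> m \<le> n"
  then show "real (alt_lambda 3 m n) \<le> real m * real n / 4"
    by (intro alt_lambda_3_le) auto
next
  \<comment> \<open>For \<open>n = 1\<close> no pair exists and \<open>alt_lambda 4 1 1\<close> is unspecified, so \<open>\<epsilon> 1\<close> has to absorb it.\<close>
  let ?\<epsilon> = "\<lambda>n. if n = 1 then 8 * real (alt_lambda 4 1 1) else 1 / (real n - 1)"
  have "(\<lambda>n. 1 / (real n - 1)) \<longlonglongrightarrow> 0"
    \<comment> \<open>Shifting the index by one turns the sequence into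
      \<open>1 / real n\<close>.\<close>
    by (rule LIMSEQ_imp_Suc) (simp add: lim_1_over_n)
  moreover have "eventually (\<lambda>n. 1 / (real n - 1) = ?\<epsilon> n) sequentially"
    using eventually_gt_at_top[of 1] by eventually_elim simp
  ultimately show "?\<epsilon> \<longlonglongrightarrow> 0"
    by (rule Lim_transform_eventually)
  fix m n :: nat assume mn: "1 \<le> m \<and> m \<le> n"
  show "real (alt_lambda 4 m n) \<le> (1 + ?\<epsilon> n) * ((real m)\<^sup>2 * real n / 8)"
  proof (cases "n = 1")
    case True
    with mn have "m = 1" by simp
    \<comment> \<open>The right-hand side is now \<open>alt_lambda 4 1 1 + 1 / 8\<close>.\<close>
    with True show ?thesis by simp
  next
    case False
    with mn show ?thesis using alt_lambda_4_le[of n m] by simp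
  qed
qed

end
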